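(* For every irrational $\alpha$ and every positive integer $n$, $$\operatorname{sgn}(\pi_{\alpha,2n})=\operatorname{sgn}(\pi_{\alpha,2n+1})=\prod_{\ell=1}^n(-1)^{\lfloor 2\ell\alpha\rfloor}.$$
   Context: $\{x\}$ denotes the fractional part of a real number $x$. For $\alpha$ irrational and $m$ a positive integer, $\pi_{\alpha,m}$ is the permutation of $\{1,2,\dots,m\}$ that orders the fractional parts $\{\alpha\},\{2\alpha\},\dots,\{m\alpha\}$, i.e. the unique permutation with $0<\{\pi_{\alpha,m}(1)\alpha\}<\{\pi_{\alpha,m}(2)\alpha\}<\dots<\{\pi_{\alpha,m}(m)\alpha\}<1$. For a permutation $\sigma$, $\operatorname{sgn}(\sigma)=1$ if $\sigma$ is even and $\operatorname{sgn}(\sigma)=-1$ if $\sigma$ is odd. *)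

theory Defs
  imports "HOL-Analysis.Analysis" "HOL-Combinatorics.Permutations"
begin

text \<open>
  The bounds \<open>0 < \<dots> < 1\<close> at the two ends of the chain of fractional parts are left out:
  they hold for every positive integer multiple of an irrational number.
\<close>

definition sorts_fracs :: "real \<Rightarrow> nat \<Rightarrow> (nat \<Rightarrow> nat) \<Rightarrow> bool" where
  "sorts_fracs \<alpha> m p \<longleftrightarrow>
     p permutes {1..m} \<and> strict_mono_on {1..m} (\<lambda>i. frac (real (p i) * \<alpha>))"

definition frac_perm :: "real \<Rightarrow> nat \<Rightarrow> nat \<Rightarrow> nat" where
  "frac_perm \<alpha> m = (THE p. sorts_fracs \<alpha> m p)"

lemma inj_frac_mult_irrational:
  fixes \<alpha> :: real
  assumes "\<alpha> \<notin> \<rat>"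
  shows "inj (\<lambda>k::nat. frac (real k * \<alpha>))"
proof (rule injI, rule ccontr)
  fix j k :: nat
  assume eq: "frac (real j * \<alpha>) = frac (real k * \<alpha>)" and ne: "j \<noteq> k"
  have "(real j - real k) * \<alpha> = of_int (\<lfloor>real j * \<alpha>\<rfloor> - \<lfloor>real k * \<alpha>\<rfloor>)"
    using eq by (simp add: frac_def algebra_simps)
  then have "\<alpha> = of_int (\<lfloor>real j * \<alpha>\<rfloor> - \<lfloor>real k * \<alpha>\<rfloor>) / (real j - real k)"
    using ne by (simp add: field_simps)
  also have "\<dots> \<in> \<rat>"
    by (intro Rats_divide Rats_diff Rats_of_int Rats_of_nat)
  finally show False
    using assms by simp
qed

lemma ex1_sorts_fracs:
  fixes \<alpha> :: real
  assumes "\<alpha> \<notin> \<rat>"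
  shows "\<exists>!p. sorts_fracs \<alpha> m p"
proof -
  define f where "f = (\<lambda>k::nat. frac (real k * \<alpha>))"
  have inj: "inj f"
    unfolding f_def by (rule inj_frac_mult_irrational[OF assms])
  define xs where "xs = sorted_list_of_set (f ` {1..m})"
  have len: "length xs = m"
    using inj by (simp add: xs_def card_image inj_on_subset)
  have set_xs: "set xs = f ` {1..m}" and dist: "distinct xs" and sorted: "sorted_wrt (<) xs"
    by (simp_all add: xs_def)
  define p where "p = (\<lambda>i. if i \<in> {1..m} then the_inv f (xs ! (i - 1)) else i)"
  have fp: "p i \<in> {1..m} \<and> f (p i) = xs ! (i - 1)" if "i \<in> {1..m}" for i
  proof -
    have "xs ! (i - 1) \<in> f ` {1..m}"
      unfolding set_xs[symmetric] using that len by (intro nth_mem) auto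
    then obtain k where "k \<in> {1..m}" "xs ! (i - 1) = f k"
      by blast
    then show ?thesis
      using that by (simp add: p_def the_inv_f_f[OF inj])
  qed
  have mono: "strict_mono_on {1..m} (\<lambda>i. f (p i))"
  proof (rule strict_mono_onI)
    fix i j assume "i \<in> {1..m}" "j \<in> {1..m}" "i < j"
    moreover from this have "xs ! (i - 1) < xs ! (j - 1)"
      using len by (intro sorted_wrt_nth_less[OF sorted]) auto
    ultimately show "f (p i) < f (p j)"
      using fp by metis
  qed
  have "inj_on p {1..m}"
    using strict_mono_on_imp_inj_on[OF mono] unfolding inj_on_def by metis
  moreover have "p ` {1..m} \<subseteq> {1..m}"
    using fp by blast
  ultimately have "bij_betw p {1..m} {1..m}"
    unfolding bij_betw_def by (intro conjI endo_inj_surj) simp_all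
  then have "p permutes {1..m}"
    by (rule bij_imp_permutes) (auto simp: p_def)
  then have ex: "sorts_fracs \<alpha> m p"
    using mono by (simp add: sorts_fracs_def f_def)
  have list: "map (\<lambda>i. f (q i)) [1..<Suc m] = xs" if "sorts_fracs \<alpha> m q" for q
  proof (rule strict_sorted_equal)
    have q: "q permutes {1..m}" and mq: "strict_mono_on {1..m} (\<lambda>i. f (q i))"
      using that by (simp_all add: sorts_fracs_def f_def)
    have "f (q i) < f (q j)" if "i \<in> set [1..<Suc m]" "j \<in> set [1..<Suc m]" "i < j" for i j
      using that by (intro strict_mono_onD[OF mq]) (auto simp del: upt_Suc)
    then show "sorted_wrt (<) (map (\<lambda>i. f (q i)) [1..<Suc m])"
      unfolding sorted_wrt_map by (rule sorted_wrt_mono_rel[OF _ sorted_wrt_upt])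
    have "set (map (\<lambda>i. f (q i)) [1..<Suc m]) = f ` (q ` {1..m})"
      by (auto simp del: upt_Suc)
    then show "set (map (\<lambda>i. f (q i)) [1..<Suc m]) = set xs"
      using set_xs permutes_image[OF q] by simp
  qed (rule sorted)
  have "q = p" if q: "sorts_fracs \<alpha> m q" for q
  proof
    fix i
    show "q i = p i"
    proof (cases "i \<in> {1..m}")
      case True
      have "map (\<lambda>i. f (q i)) [1..<Suc m] = map (\<lambda>i. f (p i)) [1..<Suc m]"
        using list[OF q] list[OF ex] by simp
      then have "f (q i) = f (p i)"
        using True by (auto simp del: upt_Suc)
      then show ?thesis
        using inj by (simp add: inj_eq)
    next
      case False
      then show ?thesis
        using q ex permutes_not_in[of q "{1..m}" i] permutes_not_in[of p "{1..m}" i]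
        unfolding sorts_fracs_def by metis
    qed
  qed
  with ex show ?thesis by blast
qed

lemma frac_perm_sorts_fracs:
  "\<alpha> \<notin> \<rat> \<Longrightarrow> sorts_fracs \<alpha> m (frac_perm \<alpha> m)"
  unfolding frac_perm_def by (rule theI'[OF ex1_sorts_fracs])

end

theory Submission
  imports Defs
begin

text \<open>
  The Vandermonde product of a sequence \<open>x\<close> is the product of the differences \<open>x j - x i\<close> over
  \<open>1 \<le> i < j \<le> m\<close>. It is alternating: permuting its arguments multiplies it by the sign of the
  permutation (\<open>vandermonde_permutes\<close>). If the permutation sorts \<open>x\<close>, the permuted product is
  positive, and so the sign of the permutation is the product of the signs of the differences
  (\<open>sign_sorting_permutation\<close>).

  For \<open>x k = frac (k * \<alpha>)\<close> and \<open>i < j\<close>, the integer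
  \<open>\<lfloor>j * \<alpha>\<rfloor> - \<lfloor>i * \<alpha>\<rfloor> - \<lfloor>(j - i) * \<alpha>\<rfloor>\<close> is the carry in the addition of
  \<open>frac (i * \<alpha>)\<close> and \<open>frac ((j - i) * \<alpha>)\<close>; it is 1 if \<open>x j < x i\<close> and 0 otherwise. Hence
  the sign of \<open>x j - x i\<close> is \<open>h j * h i * h (j - i)\<close> where \<open>h k\<close> is the parity sign of
  \<open>\<lfloor>k * \<alpha>\<rfloor>\<close>. For fixed \<open>j\<close>, both \<open>i\<close> and \<open>j - i\<close> run through \<open>1, \<dots>, j - 1\<close>, so the last two
  factors cancel in the product over \<open>i\<close>, which leaves \<open>h j ^ (j - 1)\<close>: this is \<open>h j\<close> for even
  \<open>j\<close> and 1 for odd \<open>j\<close>.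
\<close>

definition vandermonde :: "nat \<Rightarrow> (nat \<Rightarrow> 'a::comm_ring_1) \<Rightarrow> 'a" where
  "vandermonde m x = (\<Prod>(i, j)\<in>{(i, j). 1 \<le> i \<and> i < j \<and> j \<le> m}. x j - x i)"

lemma finite_ordered_pairs: "finite {(i, j). 1 \<le> i \<and> i < j \<and> j \<le> (m::nat)}"
  by (rule finite_subset[of _ "{..m} \<times> {..m}"]) auto

lemma vandermonde_altdef:
  "vandermonde m x = (\<Prod>j = 1..m. \<Prod>i = 1..<j. x j - x i)"
  unfolding vandermonde_def
  by (subst prod.Sigma) (auto intro!: prod.reindex_bij_witness[of _ prod.swap prod.swap])

text \<open>
  An adjacent transposition permutes the ordered pairs other than the pair of the two
  transposed indices, whose difference changes its sign.
\<close>

lemma vandermonde_adjacent_transpose: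
  assumes "1 \<le> k" "k < m"
  shows "vandermonde m (x \<circ> Transposition.transpose k (Suc k)) = - vandermonde m x"
proof -
  define P where "P = {(i, j). 1 \<le> i \<and> i < j \<and> j \<le> m}"
  let ?t = "Transposition.transpose k (Suc k)"
  have fin: "finite P" and mem: "(k, Suc k) \<in> P"
    using assms finite_ordered_pairs[of m] by (simp_all add: P_def)
  have rest: "(\<Prod>(i, j)\<in>P - {(k, Suc k)}. x (?t j) - x (?t i)) =
      (\<Prod>(i, j)\<in>P - {(k, Suc k)}. x j - x i)"
    by (rule prod.reindex_bij_witness[of _ "map_prod ?t ?t" "map_prod ?t ?t"])
      (use assms in \<open>auto simp: P_def Transposition.transpose_def split: if_splits\<close>)
  show ?thesis
    unfolding vandermonde_def P_def[symmetric] prod.remove[OF fin mem] using rest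
    by (simp add: algebra_simps)
qed

text \<open>
  The transposition of \<open>a\<close> and \<open>b + 1\<close> is the one of \<open>a\<close> and \<open>b\<close> conjugated by the
  transposition of \<open>b\<close> and \<open>b + 1\<close>. By induction on \<open>b\<close>, each of these three transpositions
  changes the sign.
\<close>

lemma vandermonde_transpose_less:
  assumes "a < b" "1 \<le> a" "b \<le> m"
  shows "vandermonde m (x \<circ> Transposition.transpose a b) = - vandermonde m x"
proof -
  have "Suc a \<le> b" using assms(1) by simp
  then show ?thesis
    using assms(2,3)
  proof (induction b arbitrary: x rule: dec_induct)
    case base
    then show ?case
      by (intro vandermonde_adjacent_transpose) auto
  next
    case (step c)
    let ?t = "Transposition.transpose c (Suc c)"
    have "x \<circ> Transposition.transpose a (Suc c) = ((x \<circ> ?t) \<circ> Transposition.transpose a c) \<circ> ?t"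
      using step.hyps by (auto simp: fun_eq_iff Transposition.transpose_def)
    then show ?case
      using step by (simp only: vandermonde_adjacent_transpose step.IH) simp
  qed
qed

lemma vandermonde_transpose:
  assumes "a \<in> {1..m}" "b \<in> {1..m}" "a \<noteq> b"
  shows "vandermonde m (x \<circ> Transposition.transpose a b) = - vandermonde m x"
proof (cases "a < b")
  case True
  then show ?thesis using assms by (intro vandermonde_transpose_less) auto
next
  case False
  then show ?thesis
    using assms vandermonde_transpose_less[of b a m x] by (simp add: transpose_commute)
qed

lemma vandermonde_permutes:
  assumes "p permutes {1..m}"
  shows "vandermonde m (x \<circ> p) = of_int (sign p) * vandermonde m x"
  using assms finite_atLeastAtMost
proof (induction arbitrary: x rule: permutes_induct)
  case id
  show ?case by simp
next
  case (swap a b p)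
  have "vandermonde m (x \<circ> (Transposition.transpose a b \<circ> p)) =
      of_int (sign p) * vandermonde m (x \<circ> Transposition.transpose a b)"
    using swap.IH[of "x \<circ> Transposition.transpose a b"] by (simp only: comp_assoc)
  moreover have "sign (Transposition.transpose a b \<circ> p) = (if a = b then 1 else -1) * sign p"
    using sign_compose[OF permutation_swap_id permutes_imp_permutation[OF _ swap.hyps(4)]]
    by (simp add: sign_swap_id)
  moreover have "vandermonde m (x \<circ> Transposition.transpose a b) = - vandermonde m x"
    by (rule vandermonde_transpose) (fact swap.hyps)+
  ultimately show ?case
    using swap.hyps(3) by (simp only:) simp
qed

lemma sgn_prod:
  fixes f :: "'b \<Rightarrow> real"
  shows "sgn (prod f A) = (\<Prod>a\<in>A. sgn (f a))"
  by (induction A rule: infinite_finite_induct) (simp_all add: sgn_mult)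

lemma sign_sorting_permutation:
  fixes x :: "nat \<Rightarrow> real"
  assumes p: "p permutes {1..m}" and mono: "strict_mono_on {1..m} (\<lambda>i. x (p i))"
  shows "real_of_int (sign p) = (\<Prod>j = 1..m. \<Prod>i = 1..<j. sgn (x j - x i))"
proof -
  have "vandermonde m (x \<circ> p) > 0"
    unfolding vandermonde_altdef
    by (intro prod_pos) (auto intro!: strict_mono_onD[OF mono])
  then have "of_int (sign p) * vandermonde m x > 0"
    by (simp add: vandermonde_permutes[OF p])
  then have "real_of_int (sign p) = sgn (vandermonde m x)"
    by (cases rule: sign_cases[of p]) auto
  then show ?thesis
    by (simp add: vandermonde_altdef sgn_prod)
qed

definition floor_sign :: "real \<Rightarrow> nat \<Rightarrow> real" where
  "floor_sign \<alpha> k = (-1) powi \<lfloor>real k * \<alpha>\<rfloor>"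

lemma floor_sign_square: "floor_sign \<alpha> k * floor_sign \<alpha> k = 1"
  by (simp add: floor_sign_def power_int_minus_one_mult_self)

text \<open>
  If the addition of \<open>frac (i * \<alpha>)\<close> and \<open>frac ((j - i) * \<alpha>)\<close> has no carry, then the floors
  add up, the exponent on the right is even, and \<open>frac (j * \<alpha>)\<close> is the larger fractional part;
  it differs from \<open>frac (i * \<alpha>)\<close> because \<open>\<alpha>\<close> is irrational. With a carry, the exponent is odd
  and the order is reversed.
\<close>

lemma sgn_frac_diff:
  fixes \<alpha> :: real
  assumes "\<alpha> \<notin> \<rat>" and "i < j"
  shows "sgn (frac (real j * \<alpha>) - frac (real i * \<alpha>)) =
    floor_sign \<alpha> j * floor_sign \<alpha> i * floor_sign \<alpha> (j - i)"
proof -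
  let ?f = "\<lambda>k::nat. frac (real k * \<alpha>)"
  have split: "real j * \<alpha> = real i * \<alpha> + real (j - i) * \<alpha>"
    using assms(2) by (simp add: of_nat_diff algebra_simps)
  have ne: "?f j \<noteq> ?f i"
    using inj_frac_mult_irrational[OF assms(1)] assms(2) by (auto dest: injD)
  have fs: "floor_sign \<alpha> j * floor_sign \<alpha> i * floor_sign \<alpha> (j - i) =
      (-1) powi (\<lfloor>real j * \<alpha>\<rfloor> + \<lfloor>real i * \<alpha>\<rfloor> + \<lfloor>real (j - i) * \<alpha>\<rfloor>)"
    by (simp add: floor_sign_def power_int_add)
  show ?thesis
  proof (cases "?f i + ?f (j - i) < 1")
    case True
    then have "?f j = ?f i + ?f (j - i)"
      and "\<lfloor>real j * \<alpha>\<rfloor> = \<lfloor>real i * \<alpha>\<rfloor> + \<lfloor>real (j - i) * \<alpha>\<rfloor>"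
      unfolding split by (simp_all add: frac_add floor_add)
    moreover have "?f (j - i) \<ge> 0" by simp
    ultimately show ?thesis
      using ne unfolding fs by (simp add: power_int_minus_left)
  next
    case False
    then have "?f j = ?f i + ?f (j - i) - 1"
      and "\<lfloor>real j * \<alpha>\<rfloor> = \<lfloor>real i * \<alpha>\<rfloor> + \<lfloor>real (j - i) * \<alpha>\<rfloor> + 1"
      unfolding split by (simp_all add: frac_add floor_add)
    moreover have "?f (j - i) < 1" by (rule frac_lt_1)
    ultimately show ?thesis
      unfolding fs by (simp add: power_int_minus_left)
  qed
qed

text \<open>
  The reflection \<open>i \<mapsto> j - i\<close> turns the product of the third factors into that of the second
  ones, and every factor squares to 1.
\<close>

lemma prod_sgn_frac_diff:
  fixes \<alpha> :: real
  assumes "\<alpha> \<notin> \<rat>"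
  shows "(\<Prod>i = 1..<j. sgn (frac (real j * \<alpha>) - frac (real i * \<alpha>))) =
    floor_sign \<alpha> j ^ (j - 1)"
proof -
  let ?h = "floor_sign \<alpha>"
  have "(\<Prod>i = 1..<j. sgn (frac (real j * \<alpha>) - frac (real i * \<alpha>))) =
      (\<Prod>i = 1..<j. ?h j * ?h i * ?h (j - i))"
    by (intro prod.cong refl sgn_frac_diff[OF assms]) simp
  also have "\<dots> = ?h j ^ (j - 1) * (\<Prod>i = 1..<j. ?h i) * (\<Prod>i = 1..<j. ?h (j - i))"
    by (simp add: prod.distrib)
  also have "(\<Prod>i = 1..<j. ?h (j - i)) = (\<Prod>i = 1..<j. ?h i)"
    by (rule prod.reindex_bij_witness[of _ "\<lambda>i. j - i" "\<lambda>i. j - i"]) auto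
  also have "?h j ^ (j - 1) * (\<Prod>i = 1..<j. ?h i) * (\<Prod>i = 1..<j. ?h i) =
      ?h j ^ (j - 1) * (\<Prod>i = 1..<j. ?h i * ?h i)"
    by (simp add: prod.distrib mult.assoc)
  finally show ?thesis
    by (simp add: floor_sign_square)
qed

lemma sign_frac_perm:
  assumes "\<alpha> \<notin> \<rat>"
  shows "real_of_int (sign (frac_perm \<alpha> m)) = (\<Prod>j = 1..m. floor_sign \<alpha> j ^ (j - 1))"
proof -
  have "sorts_fracs \<alpha> m (frac_perm \<alpha> m)"
    by (rule frac_perm_sorts_fracs[OF assms])
  then have "real_of_int (sign (frac_perm \<alpha> m)) =
      (\<Prod>j = 1..m. \<Prod>i = 1..<j. sgn (frac (real j * \<alpha>) - frac (real i * \<alpha>)))"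
    unfolding sorts_fracs_def by (intro sign_sorting_permutation) auto
  then show ?thesis
    by (simp only: prod_sgn_frac_diff[OF assms])
qed

lemma floor_sign_even_power: "floor_sign \<alpha> k ^ (2 * i) = 1"
  by (simp add: power_mult power2_eq_square floor_sign_square)

lemma prod_floor_sign_even:
  "(\<Prod>j = 1..2 * n. floor_sign \<alpha> j ^ (j - 1)) = (\<Prod>l = 1..n. floor_sign \<alpha> (2 * l))"
proof (induction n)
  case 0
  show ?case by simp
next
  case (Suc n)
  have "floor_sign \<alpha> (2 * Suc n) ^ (2 * Suc n - 1) = floor_sign \<alpha> (2 * Suc n)"
    using floor_sign_even_power[of \<alpha> "2 * Suc n" n] by simp
  then show ?case
    using Suc.IH floor_sign_even_power[of \<alpha> "Suc (2 * n)" n] by simp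
qed

theorem theorem1p3:
  fixes \<alpha> :: real and n :: nat
  assumes "\<alpha> \<notin> \<rat>" and "n \<ge> 1"
  shows "sign (frac_perm \<alpha> (2 * n)) = sign (frac_perm \<alpha> (2 * n + 1))
    \<and> real_of_int (sign (frac_perm \<alpha> (2 * n + 1))) =
        (\<Prod>l = 1..n. (-1) powi \<lfloor>2 * real l * \<alpha>\<rfloor>)"
proof -
  have even: "real_of_int (sign (frac_perm \<alpha> (2 * n))) = (\<Prod>l = 1..n. floor_sign \<alpha> (2 * l))"
    by (simp only: sign_frac_perm[OF assms(1)] prod_floor_sign_even)
  have "real_of_int (sign (frac_perm \<alpha> (2 * n + 1))) = real_of_int (sign (frac_perm \<alpha> (2 * n)))"
    using floor_sign_even_power[of \<alpha> "Suc (2 * n)" n] by (simp add: sign_frac_perm[OF assms(1)])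
  with even show ?thesis
    by (simp add: floor_sign_def)
qed

end
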